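(* Let $k\in\mathbb{Z}$, let $n\ge 0$ be an integer, and let $\lambda\in\mathbb{C}$ be nonzero. Then $$\beta_{n,\lambda}^{(-k)}=\sum_{m=0}^{n}\sum_{j=0}^{m}(-1)^{j+m}\,j!\,\lambda^{n-m}(j+1)^{k}S_{2}(m,j)S_{1}(n,m).$$
   Context: For $r\in\mathbb{Z}$, $\mathrm{Li}_r(u)=\sum_{n=1}^{\infty}\frac{u^n}{n^r}$. For nonzero $\lambda$ and $r\in\mathbb{Z}$, the fully degenerate poly-Bernoulli numbers $\beta_{n,\lambda}^{(r)}$ of index $r$ are defined by the generating function (identity of formal power series in $t$) $$\frac{\mathrm{Li}_{r}\left(1-(1+\lambda t)^{-1/\lambda}\right)}{1-(1+\lambda t)^{-1/\lambda}}=\sum_{n=0}^{\infty}\beta_{n,\lambda}^{(r)}\frac{t^{n}}{n!},$$ where $(1+\lambda t)^{a}=\sum_{j\ge0}(a)_j\lambda^j\frac{t^j}{j!}$, $(a)_j=a(a-1)\cdots(a-j+1)$ with $(a)_0=1$, and $\mathrm{Li}_r(u)/u$ denotes the series $\sum_{m\ge 0}u^m/(m+1)^r$. $S_1(n,l)$ denotes the (signed) Stirling numbers of the first kind, $(x)_n=\sum_{l=0}^n S_1(n,l)x^l$, and $S_2(n,l)$ the Stirling numbers of the second kind, $\frac{(e^t-1)^l}{l!}=\sum_{n\ge l}S_2(n,l)\frac{t^n}{n!}$. *)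

theory Defs
  imports
    Complex_Main
    "HOL-Computational_Algebra.Computational_Algebra"
    "HOL-Combinatorics.Stirling"
begin

definition falling :: "'a::comm_ring_1 \<Rightarrow> nat \<Rightarrow> 'a"
  where "falling a n = (\<Prod>i<n. a - of_nat i)"

text \<open>
  Signed Stirling numbers of the first kind, as coefficients of the falling factorial of the
  indeterminate. (The library function \<open>stirling\<close> is the unsigned version.)
\<close>
definition S1 :: "nat \<Rightarrow> nat \<Rightarrow> int"
  where "S1 n l = coeff (falling [:0, 1:] n) l"

lemma falling_eq_sum_S1:
  fixes x :: "'a::comm_ring_1"
  shows "falling x n = (\<Sum>l\<le>n. of_int (S1 n l) * x ^ l)"
proof -
  let ?p = "\<lambda>n. falling [:0, 1:] n :: int poly"
  have ev: "poly (map_poly of_int (?p n)) x = falling x n" for n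
  proof (induction n)
    case (Suc n)
    have eq: "?p (Suc n) = pCons 0 (?p n) - smult (int n) (?p n)"
      by (simp add: falling_def of_nat_poly algebra_simps)
    have "map_poly of_int (?p (Suc n)) =
        pCons 0 (map_poly of_int (?p n)) - smult (of_nat n :: 'a) (map_poly of_int (?p n))"
      unfolding eq by (rule poly_eqI) (simp add: coeff_map_poly coeff_pCons split: nat.split)
    then have "poly (map_poly of_int (?p (Suc n))) x = x * falling x n - of_nat n * falling x n"
      by (simp only: poly_diff poly_pCons poly_smult Suc) simp
    also have "\<dots> = falling x (Suc n)"
      by (simp add: falling_def algebra_simps)
    finally show ?case .
  qed (simp add: falling_def)
  have "degree (?p n) \<le> n" for n
  proof (induction n)
    case (Suc n)
    have eq: "?p (Suc n) = pCons 0 (?p n) - smult (int n) (?p n)"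
      by (simp add: falling_def of_nat_poly algebra_simps)
    show ?case unfolding eq using Suc
      by (intro degree_diff_le) (auto intro: order.trans[OF degree_pCons_le]
          order.trans[OF degree_smult_le])
  qed (simp add: falling_def)
  then have "degree (map_poly (of_int :: int \<Rightarrow> 'a) (?p n)) \<le> n"
    using map_poly_degree_leq[of "of_int :: int \<Rightarrow> 'a" "?p n"] by (meson order.trans)
  then have "poly (map_poly (of_int :: int \<Rightarrow> 'a) (?p n)) x
      = (\<Sum>l\<le>n. coeff (map_poly of_int (?p n)) l * x ^ l)"
    unfolding poly_altdef by (intro sum.mono_neutral_left) (auto intro: le_degree)
  then show ?thesis by (simp add: ev coeff_map_poly S1_def)
qed

text \<open>
  The library function \<open>Stirling\<close> gives the Stirling numbers of the second kind; it is defined by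
  the triangular recurrence, and the following lemma gives the exponential generating function.
\<close>
lemma Stirling_egf:
  "fps_const (1 / fact l) * (fps_exp 1 - 1) ^ l
    = Abs_fps (\<lambda>n. of_nat (Stirling n l) / fact n :: 'a::field_char_0)"
proof -
  define G :: "nat \<Rightarrow> 'a fps" where "G l = fps_const (1 / fact l) * (fps_exp 1 - 1) ^ l" for l
  have deriv_0: "fps_deriv (G 0) = 0"
    by (simp add: G_def)
  have deriv_Suc: "fps_deriv (G (Suc l)) = G l + of_nat (Suc l) * G (Suc l)" for l
  proof -
    have c: "fps_const (1 / fact (Suc l)) * of_nat (Suc l) = (fps_const (1 / fact l) :: 'a fps)"
      by (simp add: fps_of_nat [symmetric] field_simps del: of_nat_Suc)
    have "fps_deriv ((fps_exp 1 - 1) ^ Suc l :: 'a fps)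
        = of_nat (Suc l) * (fps_exp 1 - 1) ^ l * fps_exp 1"
      by (subst fps_deriv_power) (simp add: fps_of_nat mult_ac del: of_nat_Suc)
    then have "fps_deriv (G (Suc l))
        = fps_const (1 / fact (Suc l)) * of_nat (Suc l) * (fps_exp 1 - 1) ^ l * fps_exp 1"
      by (simp add: G_def mult.assoc del: of_nat_Suc fact_Suc power_Suc)
    also have "\<dots> = fps_const (1 / fact (Suc l)) * of_nat (Suc l) * (fps_exp 1 - 1) ^ l
        + of_nat (Suc l) * (fps_const (1 / fact (Suc l)) * (fps_exp 1 - 1) ^ Suc l)"
      by (simp add: algebra_simps del: of_nat_Suc fact_Suc)
    finally show ?thesis by (simp only: c G_def)
  qed
  have "fact n * fps_nth (G l) n = of_nat (Stirling n l)" for n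
  proof (induction n arbitrary: l)
    case 0
    show ?case by (cases l) (simp_all add: G_def)
  next
    case (Suc n)
    have "fact (Suc n) * fps_nth (G l) (Suc n) = fact n * fps_nth (fps_deriv (G l)) n"
      by (simp add: algebra_simps)
    also have "\<dots> = of_nat (Stirling (Suc n) l)"
    proof (cases l)
      case 0
      then show ?thesis by (simp add: deriv_0)
    next
      case (Suc k)
      have "fact n * fps_nth (fps_deriv (G l)) n
          = fact n * fps_nth (G k) n + of_nat (Suc k) * (fact n * fps_nth (G (Suc k)) n)"
        by (simp add: Suc deriv_Suc fps_of_nat [symmetric] algebra_simps
          del: fps_deriv_nth of_nat_Suc)
      then show ?thesis by (simp add: Suc.IH Suc algebra_simps)
    qed
    finally show ?case .
  qed
  then show ?thesis by (intro fps_ext) (simp add: G_def field_simps)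
qed

definition fps_polylog :: "int \<Rightarrow> complex fps"
  where "fps_polylog r = Abs_fps (\<lambda>n. if n = 0 then 0 else 1 / of_nat n powi r)"

text \<open>The series \<open>Li\<^sub>r(u) / u\<close>.\<close>
definition fps_polylog_quot :: "int \<Rightarrow> complex fps"
  where "fps_polylog_quot r = Abs_fps (\<lambda>m. 1 / of_nat (m + 1) powi r)"

lemma fps_polylog_quot: "fps_polylog r = fps_X * fps_polylog_quot r"
  by (rule fps_ext) (simp add: fps_polylog_def fps_polylog_quot_def)

text \<open>The series \<open>(1 + \<lambda> t)\<^sup>a\<close>.\<close>
definition fps_deg_binomial :: "complex \<Rightarrow> complex \<Rightarrow> complex fps"
  where "fps_deg_binomial l a = Abs_fps (\<lambda>j. falling a j * l ^ j / fact j)"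

lemma fps_deg_binomial_conv_binomial:
  "fps_deg_binomial l a = fps_binomial a oo (fps_const l * fps_X)"
  by (rule fps_ext)
    (simp add: fps_deg_binomial_def falling_def gbinomial_prod_rev atLeast0LessThan
      fps_compose_linear)

definition deg_poly_Bernoulli_gf :: "complex \<Rightarrow> int \<Rightarrow> complex fps"
  where "deg_poly_Bernoulli_gf l r = fps_polylog_quot r oo (1 - fps_deg_binomial l (- 1 / l))"

text \<open>
  The inner series of the composition has zero constant term, so the composition is the genuine
  substitution, and the generating function is the quotient of \<open>Li\<^sub>r(u)\<close> by \<open>u\<close> at that series.
\<close>
lemma deg_poly_Bernoulli_gf_quotient:
  fixes l :: complex
  assumes "l \<noteq> 0"
  defines "u \<equiv> 1 - fps_deg_binomial l (- 1 / l)"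
  shows "fps_nth u 0 = 0" and "u \<noteq> 0" and "deg_poly_Bernoulli_gf l r = (fps_polylog r oo u) / u"
proof -
  show u0: "fps_nth u 0 = 0" by (simp add: u_def fps_deg_binomial_def falling_def)
  have "fps_nth u 1 = 1" using assms(1) by (simp add: u_def fps_deg_binomial_def falling_def)
  then show nz: "u \<noteq> 0" by auto
  have "fps_polylog r oo u = u * deg_poly_Bernoulli_gf l r"
    using u0 by (simp add: fps_polylog_quot fps_compose_mult_distrib deg_poly_Bernoulli_gf_def u_def)
  then show "deg_poly_Bernoulli_gf l r = (fps_polylog r oo u) / u" using nz by simp
qed

text \<open>The fully degenerate poly-Bernoulli number \<open>\<beta>\<^bsub>n,\<lambda>\<^esub>\<^sup>(\<^sup>r\<^sup>)\<close>, with argument order \<open>\<lambda>\<close>, \<open>r\<close>, \<open>n\<close>.\<close>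
definition deg_poly_Bernoulli :: "complex \<Rightarrow> int \<Rightarrow> nat \<Rightarrow> complex"
  where "deg_poly_Bernoulli l r n = fact n * fps_nth (deg_poly_Bernoulli_gf l r) n"

end

(*
  Write u = 1 - (1 + \<lambda> t)^(-1/\<lambda>). Expanding u^j binomially gives the powers (1 + \<lambda> t)^(-i/\<lambda>), whose
  coefficients are falling factorials of -i/\<lambda>, that is, polynomials in i with coefficients S1(n,m).
  The alternating binomial sum of i^m over i then produces j! S2(m,j).
*)
theory Submission
  imports Defs
begin

text \<open>Both sides come from the coefficient of t^m in (e^t - 1)^j: the binomial expansion into
  the series e^(i t) gives the sum, and \<open>Stirling_egf\<close> gives the closed form.\<close>

lemma alternating_binomial_power_sum:
  "(\<Sum>i\<le>j. of_nat (j choose i) * (- 1) ^ i * of_nat i ^ m)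
    = ((- 1) ^ j * fact j * of_nat (Stirling m j) :: 'a::field_char_0)"
proof -
  have "(fps_exp 1 - 1 :: 'a fps) ^ j
      = (\<Sum>i\<le>j. of_nat (j choose i) * fps_exp 1 ^ i * (- 1) ^ (j - i))"
    using binomial_ring[of "fps_exp 1" "- 1 :: 'a fps" j] by simp
  also have "\<dots> = (\<Sum>i\<le>j. fps_const (of_nat (j choose i) * (- 1) ^ (j - i)) * fps_exp (of_nat i))"
    by (intro sum.cong)
      (simp_all add: fps_exp_power_mult mult_ac fps_const_power[symmetric] fps_of_nat[symmetric]
        fps_const_neg[symmetric] fps_const_mult[symmetric]
        del: fps_const_power fps_const_neg fps_const_mult)
  finally have "fps_nth ((fps_exp 1 - 1 :: 'a fps) ^ j) m
      = (\<Sum>i\<le>j. of_nat (j choose i) * (- 1) ^ (j - i) * (of_nat i ^ m / fact m))"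
    by (simp add: fps_sum_nth)
  moreover have "fps_nth ((fps_exp 1 - 1 :: 'a fps) ^ j) m = fact j * of_nat (Stirling m j) / fact m"
    using arg_cong[OF Stirling_egf[of j, where 'a = 'a], of "\<lambda>f. fps_nth f m"]
    by (simp add: field_simps)
  ultimately have sum: "(\<Sum>i\<le>j. of_nat (j choose i) * (- 1) ^ (j - i) * of_nat i ^ m)
      = (fact j * of_nat (Stirling m j) :: 'a)"
    by (simp add: sum_divide_distrib[symmetric])
  \<comment> \<open>Expanding (e^t - 1)^j attaches the sign (-1)^(j-i) to the i-th term; passing to
    (-1)^i costs the global factor (-1)^j.\<close>
  have flip: "of_nat (j choose i) * (- 1) ^ i * of_nat i ^ m
      = (- 1) ^ j * (of_nat (j choose i) * (- 1) ^ (j - i) * of_nat i ^ m :: 'a)" if "i \<le> j" for i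
  proof -
    have "(- 1) ^ i = (- 1) ^ j * ((- 1) ^ (j - i) :: 'a)"
      using that by (simp add: minus_one_power_iff)
    then show ?thesis by (simp only: mult_ac)
  qed
  have "(\<Sum>i\<le>j. of_nat (j choose i) * (- 1) ^ i * of_nat i ^ m)
      = (- 1) ^ j * (\<Sum>i\<le>j. of_nat (j choose i) * (- 1) ^ (j - i) * of_nat i ^ m :: 'a)"
    unfolding sum_distrib_left by (intro sum.cong refl flip) simp
  then show ?thesis
    unfolding sum by (simp only: mult.assoc)
qed

text \<open>Substituting \<lambda> t for t commutes with powers, so this reduces to the power law
  for (1 + t)^a.\<close>

lemma fps_deg_binomial_power: "fps_deg_binomial l a ^ i = fps_deg_binomial l (of_nat i * a)"
  by (simp add: fps_deg_binomial_conv_binomial fps_compose_power fps_binomial_power)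

text \<open>The factor l^n clears the denominator l^m of each term, as m \<le> n; this is the source
  of \<lambda>^(n-m) in the theorem.\<close>

lemma falling_divide_mult_power:
  fixes l :: complex
  assumes "l \<noteq> 0"
  shows "falling (x / l) n * l ^ n = (\<Sum>m\<le>n. of_int (S1 n m) * x ^ m * l ^ (n - m))"
  using assms
  by (simp add: falling_eq_sum_S1 sum_distrib_right power_divide power_diff)

lemma one_minus_fps_deg_binomial_power_nth:
  fixes l :: complex
  assumes "l \<noteq> 0"
  shows "fact n * fps_nth ((1 - fps_deg_binomial l (- 1 / l)) ^ j) n
    = (\<Sum>m\<le>n. (- 1) ^ (j + m) * fact j * l ^ (n - m) * of_nat (Stirling m j) * of_int (S1 n m))"
proof -
  let ?B = "\<lambda>i. fps_deg_binomial l (- of_nat i / l)"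
  have "(1 - fps_deg_binomial l (- 1 / l)) ^ j
      = (\<Sum>i\<le>j. of_nat (j choose i) * (- fps_deg_binomial l (- 1 / l)) ^ i)"
    using binomial_ring[of "- fps_deg_binomial l (- 1 / l)" 1 j] by simp
  also have "\<dots> = (\<Sum>i\<le>j. fps_const (of_nat (j choose i) * (- 1) ^ i) * ?B i)"
  proof (intro sum.cong refl)
    fix i
    have "(- fps_deg_binomial l (- 1 / l)) ^ i = fps_const ((- 1) ^ i) * ?B i"
      by (subst power_minus)
        (simp add: fps_deg_binomial_power fps_const_power[symmetric] fps_const_neg[symmetric]
          del: fps_const_power fps_const_neg)
    then show "of_nat (j choose i) * (- fps_deg_binomial l (- 1 / l)) ^ i
        = fps_const (of_nat (j choose i) * (- 1) ^ i) * ?B i"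
      by (simp only: fps_of_nat[symmetric] fps_const_mult[symmetric] mult.assoc)
  qed
  finally have "fact n * fps_nth ((1 - fps_deg_binomial l (- 1 / l)) ^ j) n
      = (\<Sum>i\<le>j. of_nat (j choose i) * (- 1) ^ i * (falling (- of_nat i / l) n * l ^ n))"
    by (simp add: fps_sum_nth fps_deg_binomial_def sum_distrib_left mult_ac)
  \<comment> \<open>The sign (-1)^m comes from (-i)^m. Everything depending on i is gathered in the
    last factor, ready for the interchange of sums.\<close>
  also have "\<dots> = (\<Sum>i\<le>j. \<Sum>m\<le>n. (- 1) ^ m * l ^ (n - m) * of_int (S1 n m)
      * (of_nat (j choose i) * (- 1) ^ i * of_nat i ^ m))"
    unfolding falling_divide_mult_power[OF assms] sum_distrib_left
    by (intro sum.cong refl) (simp add: power_minus[of "of_nat _"] mult_ac)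
  also have "\<dots> = (\<Sum>m\<le>n. (- 1) ^ m * l ^ (n - m) * of_int (S1 n m)
      * (\<Sum>i\<le>j. of_nat (j choose i) * (- 1) ^ i * of_nat i ^ m))"
    by (subst sum.swap) (simp add: sum_distrib_left)
  finally show ?thesis
    unfolding alternating_binomial_power_sum by (simp add: power_add mult_ac)
qed

theorem theorem6:
  fixes k :: int and n :: nat and lam :: complex
  assumes "lam \<noteq> 0"
  shows "deg_poly_Bernoulli lam (- k) n =
    (\<Sum>m = 0..n. \<Sum>j = 0..m.
      (- 1) ^ (j + m) * fact j * lam ^ (n - m) * of_nat (j + 1) powi k
        * of_nat (Stirling m j) * of_int (S1 n m))"
proof -
  let ?t = "\<lambda>m j. (- 1) ^ (j + m) * fact j * lam ^ (n - m) * of_nat (j + 1) powi k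
        * of_nat (Stirling m j) * of_int (S1 n m) :: complex"
  \<comment> \<open>The coefficient of t^n in the composition involves only the powers j \<le> n of
    the inner series, and the negative index turns 1/(j+1)^(-k) into (j+1)^k.\<close>
  have "deg_poly_Bernoulli lam (- k) n
      = (\<Sum>j = 0..n. of_nat (j + 1) powi k
          * (fact n * fps_nth ((1 - fps_deg_binomial lam (- 1 / lam)) ^ j) n))"
    by (simp add: deg_poly_Bernoulli_def deg_poly_Bernoulli_gf_def fps_compose_nth
        fps_polylog_quot_def sum_distrib_left power_int_minus field_simps)
  also have "\<dots> = (\<Sum>j = 0..n. \<Sum>m = 0..n. ?t m j)"
    unfolding one_minus_fps_deg_binomial_power_nth[OF assms] sum_distrib_left atLeast0AtMost
    by (intro sum.cong refl) (simp only: mult_ac)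
  also have "\<dots> = (\<Sum>m = 0..n. \<Sum>j = 0..n. ?t m j)"
    by (rule sum.swap)
  \<comment> \<open>The terms with j > m vanish because \<open>Stirling m j\<close> is then
    0.\<close>
  also have "\<dots> = (\<Sum>m = 0..n. \<Sum>j = 0..m. ?t m j)"
    by (intro sum.cong refl sum.mono_neutral_right) auto
  finally show ?thesis .
qed

end
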